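(* Let $\mathbf{D}_{prior}\in\mathbb{C}^{N\times N}$ satisfy $\mathbf{D}_{prior}^H\mathbf{D}_{prior}=\mathbf{I}$, let $\mathbf{r}\in\mathbb{C}^{N\times1}$ be a nonzero reference vector, $j\in\{1,\dots,N\}$, and let $\mathbf{D}_{post}$ be the HOT posterior transform domain built from $\mathbf{D}_{prior}$, $\mathbf{r}$ and $j$ (defined in the context). Let $\mathbf{x}\in\mathbb{C}^{N\times 1}$ be a nonzero vector (the true signal) with representations $\mathbf{w}_{prior}$ and $\mathbf{w}_{post}$ in the two domains, i.e. $$\mathbf{x}=\mathbf{D}_{prior}\mathbf{w}_{prior}=\mathbf{D}_{post}\mathbf{w}_{post},$$ and let $$\rho=\frac{|\mathbf{r}^H\mathbf{x}|}{\|\mathbf{r}\|_2\|\mathbf{x}\|_2}.$$ (a) If $\rho\ge\sqrt{\gamma(\mathbf{w}_{prior})}$, then $\gamma(\mathbf{w}_{post})\ge\gamma(\mathbf{w}_{prior})$. (b) Let $\mathbf{w}=\mathbf{D}_{prior}^H\mathbf{r}$. If $\operatorname{supp}(\mathbf{w})\subseteq\operatorname{supp}(\mathbf{w}_{prior})$ and $\mathbf{r}^H\mathbf{D}_{prior,j}\ne0$, then $\|\mathbf{w}_{post}\|_0\le\|\mathbf{w}_{prior}\|_0$. (c) Define $$odd=\frac{\|\mathbf{w}_{prior}\|_1}{\|\mathbf{w}_{prior}\|_2},\qquad 1\le odd\le\sqrt{N}.$$ Then $\|\mathbf{w}_{post}\|_1\le\|\mathbf{w}_{prior}\|_1$ holds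 in each of the following cases: (i) $1\le odd\le\sqrt{N-1}$ and $$\rho\ge\frac{odd+\sqrt{(N-1)(N-odd^2)}}{N};$$ (ii) $\sqrt{N-1}\le odd\le\sqrt{N}$ and $$\rho\ge\frac{odd+\sqrt{(N-1)(N-odd^2)}}{N}\quad\text{or}\quad\rho\le\frac{odd-\sqrt{(N-1)(N-odd^2)}}{N}.$$
   Context: $(\cdot)^H$ denotes conjugate transpose, $\mathbf{e}_j$ is the $j$-th standard basis vector, $\mathbf{D}_{prior,j}$ is the $j$-th column of $\mathbf{D}_{prior}$, $\|\cdot\|_0$ is the number of nonzero entries, $\operatorname{supp}$ is the set of indices of nonzero entries, and $\|\cdot\|_1,\|\cdot\|_2$ are the $\ell_1$ and $\ell_2$ norms on $\mathbb{C}^N$. Energy concentration of a nonzero $\mathbf{a}\in\mathbb{C}^N$: $\gamma(\mathbf{a})=\dfrac{\max_{1\le i\le N}|a_i|^2}{\|\mathbf{a}\|_2^2}$. HOT (Householder Optimal Transformation): given a unitary $\mathbf{D}_{prior}$, a reference vector $\mathbf{r}\in\mathbb{C}^N$ and an index $j$, put $\mathbf{w}=\mathbf{D}_{prior}^H\mathbf{r}$ and let $\alpha\in\mathbb{C}$ be a scalar with $|\alpha|=\|\mathbf{r}\|_2$ and $\alpha\mathbf{w}^H\mathbf{e}_j\in\mathbb{R}$. If $\mathbf{r}=\alpha\mathbf{D}_{prior,j}$, then $\mathbf{D}_{post}=\mathbf{D}_{prior}$. Otherwise $$\mathbf{D}_{post}=\mathbf{D}_{prior}-\frac{2}{\|\mathbf{w}-\alpha\mathbf{e}_j\|_2^2}(\mathbf{r}-\alpha\mathbf{D}_{prior,j})(\mathbf{w}-\alpha\mathbf{e}_j)^H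 .$$ *)

theory Defs
  imports "HOL-Analysis.Analysis"
begin

(* Vectors are complex^'n and N = CARD('n); norm on complex^'n is the l2 norm. *)

definition ctranspose :: "complex^'n^'m \<Rightarrow> complex^'m^'n" where
  "ctranspose A = (\<chi> i k. cnj (A $ k $ i))"

(* u^H v: conjugate-linear in the first argument. *)
definition hdot :: "complex^'n \<Rightarrow> complex^'n \<Rightarrow> complex" where
  "hdot u v = (\<Sum>i\<in>UNIV. cnj (u $ i) * v $ i)"

(* u v^H *)
definition outer :: "complex^'m \<Rightarrow> complex^'n \<Rightarrow> complex^'n^'m" where
  "outer u v = (\<chi> i k. u $ i * cnj (v $ k))"

definition supp :: "complex^'n \<Rightarrow> 'n set" where
  "supp a = {i. a $ i \<noteq> 0}"

definition l0norm :: "complex^'n \<Rightarrow> nat" where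
  "l0norm a = card (supp a)"

definition l1norm :: "complex^'n \<Rightarrow> real" where
  "l1norm a = (\<Sum>i\<in>UNIV. cmod (a $ i))"

(* Meant for nonzero a. *)
definition energy_conc :: "complex^'n \<Rightarrow> real" where
  "energy_conc a = (MAX i. (cmod (a $ i))\<^sup>2) / (norm a)\<^sup>2"

(* The admissible scalars: unique up to sign if w_j \<noteq> 0 and r \<noteq> 0, of arbitrary phase
   if w_j = 0, where w = D^H r. *)
definition hot_scalar ::
    "complex^'n^'n \<Rightarrow> complex^'n \<Rightarrow> 'n \<Rightarrow> complex \<Rightarrow> bool" where
  "hot_scalar D r j \<alpha> \<longleftrightarrow>
     cmod \<alpha> = norm r \<and> \<alpha> * hdot (ctranspose D *v r) (axis j 1) \<in> \<real>"

definition hot ::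
    "complex^'n^'n \<Rightarrow> complex^'n \<Rightarrow> 'n \<Rightarrow> complex \<Rightarrow> complex^'n^'n" where
  "hot D r j \<alpha> =
     (if r = \<alpha> *s column j D then D
      else
        let w = ctranspose D *v r;
            v = w - \<alpha> *s axis j 1
        in D - (2 / (norm v)\<^sup>2) *\<^sub>R outer (r - \<alpha> *s column j D) v)"

end

theory Submission
  imports Defs
begin

text \<open>
  The HOT transform is a disguised Householder reflection: with \<open>w = D\<^sup>H r\<close> and
  \<open>v = w - \<alpha> e\<^sub>j\<close>, unitarity turns the rank-one correction of \<open>D\<close> into
  \<open>D (I - 2 v v\<^sup>H / \<parallel>v\<parallel>\<^sup>2)\<close> (\<open>hot_mult_vec\<close>).  The posterior representation is therefore
  the reflection of the prior one.  The two conditions on \<open>\<alpha>\<close>, namely \<open>\<bar>\<alpha>\<bar> = \<parallel>w\<parallel>\<close> and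
  \<open>\<alpha> w\<^sup>H e\<^sub>j\<close> real, are what makes this reflection exchange \<open>w\<close> and \<open>\<alpha> e\<^sub>j\<close>
  (\<open>householder_exchange\<close>).  Since reflections are self-adjoint, the \<open>j\<close>-th posterior
  coefficient has modulus \<open>\<bar>r\<^sup>H x\<bar> / \<parallel>r\<parallel>\<close> (\<open>householder_coefficient\<close>), and since they are
  isometries, its share of the total energy is exactly \<open>\<rho>\<^sup>2\<close>.

  For the energy concentration, the largest coefficient carries at least the share \<open>\<rho>\<^sup>2\<close>.
  For the sparsity, the reflection changes a vector only by a multiple of \<open>v\<close>, whose support
  is contained in \<open>supp w \<union> {j}\<close>; the hypothesis \<open>r\<^sup>H D\<^sub>j \<noteq> 0\<close> says that \<open>j\<close> already belongs
  to \<open>supp w\<close>.  For the \<open>\<ell>\<^sub>1\<close> norm, the coefficients other than the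
  \<open>j\<close>-th have total energy \<open>(1 - \<rho>\<^sup>2) \<parallel>x\<parallel>\<^sup>2\<close>, so by Cauchy-Schwarz
  \<open>\<parallel>w_post\<parallel>\<^sub>1 \<le> (\<rho> + sqrt ((N - 1) (1 - \<rho>\<^sup>2))) \<parallel>x\<parallel>\<close>.  Comparing with
  \<open>\<parallel>w_prior\<parallel>\<^sub>1 = odd \<parallel>x\<parallel>\<close> leaves a quadratic inequality in \<open>\<rho>\<close>, and the stated
  thresholds are its two roots.  The range of \<open>odd\<close> is the usual comparison of the
  \<open>\<ell>\<^sub>1\<close> and \<open>\<ell>\<^sub>2\<close> norms.
\<close>

section \<open>The Hermitian inner product\<close>

lemma hdot_diff_right: "hdot u (a - b) = hdot u a - hdot u b"
  by (simp add: hdot_def algebra_simps sum_subtractf)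

lemma hdot_diff_left: "hdot (a - b) u = hdot a u - hdot b u"
  by (simp add: hdot_def algebra_simps sum_subtractf)

lemma hdot_scale_right: "hdot u (c *s a) = c * hdot u a"
  by (simp add: hdot_def sum_distrib_left mult_ac)

lemma hdot_scale_left: "hdot (c *s a) u = cnj c * hdot a u"
  by (simp add: hdot_def sum_distrib_left mult_ac)

lemma cnj_hdot: "cnj (hdot u v) = hdot v u"
  by (simp add: hdot_def mult.commute)

lemma norm_power2_sum: "(norm (v :: complex^'n))\<^sup>2 = (\<Sum>i\<in>UNIV. (cmod (v $ i))\<^sup>2)"
  by (simp add: norm_vec_def L2_set_def sum_nonneg)

lemma hdot_self: "hdot v v = of_real ((norm v)\<^sup>2)"
  unfolding norm_power2_sum hdot_def of_real_sum
  by (rule sum.cong) (simp_all add: complex_norm_square mult.commute del: of_real_power)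

lemma hdot_axis_right: "hdot u (axis j 1) = cnj (u $ j)"
  by (simp add: hdot_def axis_def if_distrib cong: if_cong)

lemma hdot_axis_left: "hdot (axis j 1) u = u $ j"
  by (metis cnj_hdot hdot_axis_right complex_cnj_cnj)

lemma mult_vec_axis: "A *v axis j 1 = column j (A :: complex^'n^'m)"
  by (simp add: matrix_vector_mult_def axis_def column_def vec_eq_iff if_distrib cong: if_cong)

lemma hdot_mult_vec_left: "hdot (A *v u) v = hdot u (ctranspose A *v v)"
proof -
  have "hdot (A *v u) v = (\<Sum>i\<in>UNIV. \<Sum>k\<in>UNIV. cnj (A $ i $ k) * cnj (u $ k) * v $ i)"
    by (simp add: hdot_def matrix_vector_mult_def sum_distrib_right)
  also have "\<dots> = (\<Sum>k\<in>UNIV. \<Sum>i\<in>UNIV. cnj (A $ i $ k) * cnj (u $ k) * v $ i)"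
    by (rule sum.swap)
  also have "\<dots> = hdot u (ctranspose A *v v)"
    by (simp add: hdot_def matrix_vector_mult_def ctranspose_def sum_distrib_left mult_ac)
  finally show ?thesis .
qed

section \<open>Householder reflections\<close>

text \<open>
  For \<open>v = 0\<close> the totalised division makes the reflection the identity; this absorbs the
  exceptional case in which HOT leaves the domain unchanged.
\<close>

definition householder :: "complex^'n \<Rightarrow> complex^'n \<Rightarrow> complex^'n" where
  "householder v y = y - (2 * hdot v y / of_real ((norm v)\<^sup>2)) *s v"

lemma householder_zero [simp]: "householder 0 y = y"
  by (simp add: householder_def)

lemma householder_involutive: "householder v (householder v y) = y"
proof (cases "v = 0")
  case False
  hence "hdot v (householder v y) = - hdot v y"
    by (simp add: householder_def hdot_diff_right hdot_scale_right hdot_self)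
  thus ?thesis
    unfolding householder_def[of v "householder v y"] by (simp add: householder_def)
qed simp

lemma householder_self_adjoint: "hdot (householder v y) z = hdot y (householder v z)"
  by (simp add: householder_def hdot_diff_left hdot_diff_right hdot_scale_left
        hdot_scale_right cnj_hdot)

lemma norm_eq_if_hdot_self_eq: "hdot a a = hdot b b \<Longrightarrow> norm a = norm b"
  unfolding hdot_self of_real_eq_iff by (simp add: power2_eq_iff_nonneg)

lemma norm_householder: "norm (householder v y) = norm y"
  by (rule norm_eq_if_hdot_self_eq) (simp add: householder_self_adjoint householder_involutive)

text \<open>
  Reflecting along \<open>a - b\<close> maps \<open>a\<close> to \<open>b\<close> when \<open>\<parallel>a - b\<parallel>\<^sup>2 = 2 (a - b)\<^sup>H a\<close>.  Over the complex
  numbers equal norms do not suffice for this: \<open>\<parallel>a - b\<parallel>\<^sup>2\<close> contains \<open>a\<^sup>H b + b\<^sup>H a\<close>, which equals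
  \<open>2 b\<^sup>H a\<close> only if the inner product is real.
\<close>

lemma householder_exchange:
  assumes "norm a = norm b" and "hdot a b \<in> \<real>"
  shows "householder (a - b) a = b"
proof (cases "a = b")
  case False
  have sym: "hdot b a = hdot a b"
    using assms(2) by (metis Reals_cnj_iff cnj_hdot)
  have "complex_of_real ((norm (a - b))\<^sup>2) = 2 * hdot (a - b) a"
    using assms(1) unfolding hdot_self[symmetric]
    by (simp add: hdot_diff_left hdot_diff_right sym) (simp add: hdot_self)
  moreover have "complex_of_real ((norm (a - b))\<^sup>2) \<noteq> 0"
    using False by simp
  ultimately have "2 * hdot (a - b) a / of_real ((norm (a - b))\<^sup>2) = 1"
    by simp
  thus ?thesis
    by (simp add: householder_def)
qed simp

text \<open>
  Writing \<open>\<alpha> e\<^sub>j\<close> as the image of \<open>w\<close> and moving the reflection to the other side of the inner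
  product exhibits the \<open>j\<close>-th coefficient as a correlation with \<open>w\<close>.
\<close>

lemma householder_coefficient:
  assumes "cmod \<alpha> = norm w" and "\<alpha> * hdot w (axis j 1) \<in> \<real>"
  shows "cmod (householder (w - \<alpha> *s axis j 1) p $ j) * norm w = cmod (hdot w p)"
proof -
  let ?a = "\<alpha> *s axis j 1" and ?H = "householder (w - \<alpha> *s axis j 1)"
  have "hdot ?a ?a = cnj \<alpha> * \<alpha>"
    by (simp add: hdot_scale_left hdot_scale_right hdot_axis_left)
  also have "\<dots> = hdot w w"
    unfolding hdot_self assms(1)[symmetric] complex_norm_square by (rule mult.commute)
  finally have "norm w = norm ?a"
    by (metis norm_eq_if_hdot_self_eq)
  hence "?H w = ?a"
    using assms(2) by (intro householder_exchange) (simp_all add: hdot_scale_right)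
  hence "?H ?a = w"
    by (metis householder_involutive)
  hence "hdot w p = hdot ?a (?H p)"
    by (metis householder_self_adjoint)
  also have "\<dots> = cnj \<alpha> * ?H p $ j"
    by (simp add: hdot_scale_left hdot_axis_left)
  finally show ?thesis
    using assms(1) by (simp add: norm_mult)
qed

lemma supp_householder_subset: "supp (householder v y) \<subseteq> supp y \<union> supp v"
  by (auto simp: supp_def householder_def)

section \<open>HOT as a reflected unitary transform\<close>

lemma unitary_right_inverse:
  fixes D :: "complex^'n^'n"
  assumes "ctranspose D ** D = mat 1"
  shows "D *v (ctranspose D *v y) = y"
proof -
  have "D ** ctranspose D = mat 1"
    using assms matrix_left_right_inverse by blast
  thus ?thesis
    by (simp add: matrix_vector_mul_assoc)
qed

lemma unitary_left_inverse:
  assumes "ctranspose D ** D = mat 1"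
  shows "ctranspose D *v (D *v y) = y"
  using assms by (simp add: matrix_vector_mul_assoc)

lemma unitary_norm:
  assumes "ctranspose D ** D = mat 1"
  shows "norm (D *v y) = norm y"
  by (rule norm_eq_if_hdot_self_eq)
     (simp add: hdot_mult_vec_left unitary_left_inverse[OF assms])

lemma outer_mult_vec: "outer u v *v y = hdot v y *s u"
  by (simp add: outer_def hdot_def matrix_vector_mult_def vec_eq_iff sum_distrib_left
        sum_distrib_right mult_ac)

lemma scaleR_mult_vec: "(c *\<^sub>R A) *v (y :: complex^'n) = of_real c *s (A *v y)"
  by (simp add: matrix_vector_mult_def vec_eq_iff sum_distrib_left)
     (simp add: scaleR_conv_of_real mult_ac)

lemma hot_mult_vec:
  fixes D :: "complex^'n^'n"
  assumes "ctranspose D ** D = mat 1"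
  shows "hot D r j \<alpha> *v y = D *v householder (ctranspose D *v r - \<alpha> *s axis j 1) y"
proof -
  define v where "v = ctranspose D *v r - \<alpha> *s axis j 1"
  have Dv: "D *v v = r - \<alpha> *s column j D"
    by (simp add: v_def matrix_vector_mult_diff_distrib unitary_right_inverse[OF assms]
          vector_scalar_commute mult_vec_axis)
  show ?thesis
  proof (cases "r = \<alpha> *s column j D")
    case True
    hence "D *v v = 0"
      using Dv by simp
    hence "v = 0"
      using unitary_norm[OF assms, of v] by simp
    thus ?thesis
      using True by (simp add: hot_def v_def)
  next
    case False
    hence "hot D r j \<alpha> *v y = D *v y - of_real (2 / (norm v)\<^sup>2) *s (hdot v y *s (D *v v))"
      by (simp add: hot_def Let_def v_def[symmetric] Dv matrix_vector_mult_diff_rdistrib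
            scaleR_mult_vec outer_mult_vec)
    also have "\<dots> = D *v householder v y"
      by (simp add: householder_def matrix_vector_mult_diff_distrib vector_scalar_commute
            mult_ac)
    finally show ?thesis
      by (simp add: v_def)
  qed
qed

section \<open>Norm comparisons\<close>

lemma sum_le_sqrt_card_mult_sqrt_sum:
  fixes f :: "'a \<Rightarrow> real"
  assumes "\<And>i. i \<in> A \<Longrightarrow> f i \<ge> 0"
  shows "(\<Sum>i\<in>A. f i) \<le> sqrt (real (card A) * (\<Sum>i\<in>A. (f i)\<^sup>2))"
proof -
  have "(\<Sum>i\<in>A. f i) = (\<Sum>i\<in>A. \<bar>1\<bar> * \<bar>f i\<bar>)"
    using assms by (intro sum.cong) auto
  also have "\<dots> \<le> L2_set (\<lambda>_. 1) A * L2_set f A"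
    by (rule L2_set_mult_ineq)
  finally show ?thesis
    by (simp add: L2_set_def real_sqrt_mult)
qed

lemma norm_le_l1norm: "norm a \<le> l1norm a"
  unfolding norm_vec_def l1norm_def by (rule L2_set_le_sum) simp

lemma l1norm_le: "l1norm (a :: complex^'n) \<le> sqrt (real CARD('n)) * norm a"
  using sum_le_sqrt_card_mult_sqrt_sum[of UNIV "\<lambda>i. cmod (a $ i)"]
  by (simp add: l1norm_def norm_power2_sum[symmetric] real_sqrt_mult)

lemma l1norm_le_coefficient:
  fixes a :: "complex^'n"
  shows "l1norm a \<le> cmod (a $ j) + sqrt ((real CARD('n) - 1) * ((norm a)\<^sup>2 - (cmod (a $ j))\<^sup>2))"
proof -
  have "real (card (UNIV - {j} :: 'n set)) = real CARD('n) - 1"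
    by (simp add: card_Diff_singleton of_nat_diff Suc_leI)
  moreover have "(\<Sum>i\<in>UNIV - {j}. (cmod (a $ i))\<^sup>2) = (norm a)\<^sup>2 - (cmod (a $ j))\<^sup>2"
    by (simp add: norm_power2_sum sum_diff1)
  moreover have "l1norm a = cmod (a $ j) + (\<Sum>i\<in>UNIV - {j}. cmod (a $ i))"
    by (simp add: l1norm_def sum.remove)
  ultimately show ?thesis
    using sum_le_sqrt_card_mult_sqrt_sum[of "UNIV - {j}" "\<lambda>i. cmod (a $ i)"] by simp
qed

text \<open>
  As \<open>\<rho> \<le> 1 \<le> d\<close>, the claim may be squared, which gives
  \<open>n \<rho>\<^sup>2 - 2 d \<rho> + d\<^sup>2 - (n - 1) \<ge> 0\<close>.  Multiplied by \<open>n\<close> and completed to a square, this is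
  \<open>(n \<rho> - d)\<^sup>2 \<ge> (n - 1) (n - d\<^sup>2)\<close>, which is what it means for \<open>\<rho>\<close> to lie outside the two
  thresholds.
\<close>

lemma threshold_inequality:
  fixes \<rho> d n :: real
  assumes "n \<ge> 1" "\<rho> \<le> 1" "1 \<le> d" "d \<le> sqrt n"
    and outside: "\<rho> \<ge> (d + sqrt ((n - 1) * (n - d\<^sup>2))) / n \<or>
                  \<rho> \<le> (d - sqrt ((n - 1) * (n - d\<^sup>2))) / n"
  shows "\<rho> + sqrt ((n - 1) * (1 - \<rho>\<^sup>2)) \<le> d"
proof -
  let ?s = "sqrt ((n - 1) * (n - d\<^sup>2))"
  have "d\<^sup>2 \<le> n"
    using assms by (metis abs_of_nonneg order.trans real_sqrt_le_iff real_sqrt_abs zero_le_one)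
  hence "?s\<^sup>2 = (n - 1) * (n - d\<^sup>2)" and "?s \<ge> 0"
    using assms(1) by simp_all
  moreover have "?s \<le> n * \<rho> - d \<or> ?s \<le> d - n * \<rho>"
    using outside assms(1) by (auto simp: field_simps)
  hence "?s \<le> \<bar>n * \<rho> - d\<bar>"
    by linarith
  ultimately have "(n - 1) * (n - d\<^sup>2) \<le> (n * \<rho> - d)\<^sup>2"
    by (metis abs_le_square_iff abs_of_nonneg)
  hence "0 \<le> n * ((d - \<rho>)\<^sup>2 - (n - 1) * (1 - \<rho>\<^sup>2))"
    by (simp add: power2_eq_square algebra_simps)
  hence "(n - 1) * (1 - \<rho>\<^sup>2) \<le> (d - \<rho>)\<^sup>2"
    using assms(1) by (simp add: zero_le_mult_iff)
  hence "sqrt ((n - 1) * (1 - \<rho>\<^sup>2)) \<le> d - \<rho>"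
    using assms(2,3) by (intro real_le_lsqrt) simp_all
  thus ?thesis
    by simp
qed

section \<open>The effect of HOT on a representation\<close>

theorem theorem3:
  fixes D_prior D_post :: "complex^'n^'n"
    and r x w w_prior w_post :: "complex^'n"
    and j :: 'n and \<alpha> :: complex
    and \<rho> odd_prior :: real and N :: nat
  assumes "N = CARD('n)"
    and "ctranspose D_prior ** D_prior = mat 1"
    and "r \<noteq> 0"
    and "hot_scalar D_prior r j \<alpha>"
    and "D_post = hot D_prior r j \<alpha>"
    and "x \<noteq> 0"
    and "x = D_prior *v w_prior"
    and "x = D_post *v w_post"
    and "\<rho> = cmod (hdot r x) / (norm r * norm x)"
    and "w = ctranspose D_prior *v r"
    and "odd_prior = l1norm w_prior / norm w_prior"
  shows
    "(\<rho> \<ge> sqrt (energy_conc w_prior) \<longrightarrow> energy_conc w_post \<ge> energy_conc w_prior)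
   \<and> (supp w \<subseteq> supp w_prior \<and> hdot r (column j D_prior) \<noteq> 0
        \<longrightarrow> l0norm w_post \<le> l0norm w_prior)
   \<and> (1 \<le> odd_prior \<and> odd_prior \<le> sqrt (real N))
   \<and> (1 \<le> odd_prior \<and> odd_prior \<le> sqrt (real N - 1) \<and>
        \<rho> \<ge> (odd_prior + sqrt ((real N - 1) * (real N - odd_prior\<^sup>2))) / real N
        \<longrightarrow> l1norm w_post \<le> l1norm w_prior)
   \<and> (sqrt (real N - 1) \<le> odd_prior \<and> odd_prior \<le> sqrt (real N) \<and>
        (\<rho> \<ge> (odd_prior + sqrt ((real N - 1) * (real N - odd_prior\<^sup>2))) / real N \<or>
         \<rho> \<le> (odd_prior - sqrt ((real N - 1) * (real N - odd_prior\<^sup>2))) / real N)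
        \<longrightarrow> l1norm w_post \<le> l1norm w_prior)"
proof -
  have n: "N = CARD('n)" and U: "ctranspose D_prior ** D_prior = mat 1"
    and w: "w = ctranspose D_prior *v r"
    and odd: "odd_prior = l1norm w_prior / norm w_prior"
    using assms by blast+
  define v where "v = w - \<alpha> *s axis j 1"
  have r: "r = D_prior *v w"
    by (simp add: w unitary_right_inverse[OF U])
  have "D_prior *v w_prior = D_prior *v householder v w_post"
    using assms(5,7,8) by (simp add: hot_mult_vec[OF U] v_def w)
  hence "w_prior = householder v w_post"
    by (metis unitary_left_inverse[OF U])
  hence post: "w_post = householder v w_prior"
    by (simp add: householder_involutive)
  have norm_prior: "norm w_prior = norm x" and norm_w: "norm w = norm r"
    using unitary_norm[OF U] assms(7) r by simp_all
  have norm_post: "norm w_post = norm x"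
    by (simp add: post norm_householder norm_prior)
  have x: "norm x > 0" and "norm r > 0"
    using assms by simp_all
  have "hdot r x = hdot w w_prior"
    unfolding r assms(7) hdot_mult_vec_left unitary_left_inverse[OF U] ..
  moreover have "cmod (w_post $ j) * norm w = cmod (hdot w w_prior)"
    unfolding post v_def using assms(4)
    by (intro householder_coefficient) (simp_all add: hot_scalar_def norm_w flip: w)
  ultimately have "cmod (w_post $ j) * norm r = \<rho> * norm x * norm r"
    using assms(9) x \<open>norm r > 0\<close> by (simp add: norm_w)
  hence coeff: "cmod (w_post $ j) = \<rho> * norm x"
    using \<open>norm r > 0\<close> by simp
  hence "\<rho> \<ge> 0"
    using x by (metis norm_ge_zero zero_le_mult_iff not_le)
  have "\<rho> * norm x \<le> norm x"
    using Finite_Cartesian_Product.norm_nth_le[of w_post j] by (simp add: coeff norm_post)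
  hence "\<rho> \<le> 1"
    using x by simp

  have a: "energy_conc w_post \<ge> energy_conc w_prior" if "\<rho> \<ge> sqrt (energy_conc w_prior)"
  proof -
    have "energy_conc w_prior \<le> \<rho>\<^sup>2"
      using that \<open>\<rho> \<ge> 0\<close> by (simp add: sqrt_le_D)
    also have "\<rho>\<^sup>2 = (cmod (w_post $ j))\<^sup>2 / (norm w_post)\<^sup>2"
      using x by (simp add: coeff norm_post power_mult_distrib)
    also have "\<dots> \<le> energy_conc w_post"
      unfolding energy_conc_def by (intro divide_right_mono Max_ge) auto
    finally show ?thesis .
  qed

  have b: "l0norm w_post \<le> l0norm w_prior"
    if supp: "supp w \<subseteq> supp w_prior" and nz: "hdot r (column j D_prior) \<noteq> 0"
  proof -
    have "hdot r (column j D_prior) = hdot r (D_prior *v axis j 1)"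
      by (simp add: mult_vec_axis)
    also have "\<dots> = cnj (w $ j)"
      unfolding r hdot_mult_vec_left unitary_left_inverse[OF U] by (rule hdot_axis_right)
    \<comment> \<open>Hence the entry of \<open>v\<close> altered by \<open>\<alpha> e\<^sub>j\<close> already lies in the support of \<open>w\<close>.\<close>
    finally have "j \<in> supp w"
      using nz by (simp add: supp_def)
    hence "supp v \<subseteq> supp w"
      by (auto simp: supp_def v_def axis_def)
    hence "supp w_post \<subseteq> supp w_prior"
      using supp supp_householder_subset[of v w_prior] post by blast
    thus ?thesis
      unfolding l0norm_def by (intro card_mono) simp_all
  qed

  have odd_ge: "1 \<le> odd_prior"
    using norm_le_l1norm[of w_prior] x by (simp add: odd norm_prior)
  have odd_le: "odd_prior \<le> sqrt (real N)"
    using l1norm_le[of w_prior] x by (simp add: odd n norm_prior field_simps)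

  have c: "l1norm w_post \<le> l1norm w_prior"
    if outside: "\<rho> \<ge> (odd_prior + sqrt ((real N - 1) * (real N - odd_prior\<^sup>2))) / real N \<or>
      \<rho> \<le> (odd_prior - sqrt ((real N - 1) * (real N - odd_prior\<^sup>2))) / real N"
  proof -
    have "sqrt ((real N - 1) * ((norm w_post)\<^sup>2 - (cmod (w_post $ j))\<^sup>2))
        = sqrt ((real N - 1) * (1 - \<rho>\<^sup>2) * (norm x)\<^sup>2)"
      by (simp add: coeff norm_post algebra_simps power_mult_distrib)
    also have "\<dots> = sqrt ((real N - 1) * (1 - \<rho>\<^sup>2)) * norm x"
      by (simp add: real_sqrt_mult)
    finally have "l1norm w_post \<le> (\<rho> + sqrt ((real N - 1) * (1 - \<rho>\<^sup>2))) * norm x"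
      using l1norm_le_coefficient[of w_post j]
      by (simp add: coeff n distrib_right)
    also have "\<dots> \<le> odd_prior * norm x"
      using outside odd_ge odd_le \<open>\<rho> \<le> 1\<close> x
      by (intro mult_right_mono threshold_inequality) (simp_all add: n Suc_leI)
    also have "\<dots> = l1norm w_prior"
      using x by (simp add: odd norm_prior)
    finally show ?thesis .
  qed
  show ?thesis
    using a b c odd_ge odd_le by blast
qed

end
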